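(* Every quantum complete finite-state generator (QCG) is deterministic, i.e. is a quantum deterministic finite-state generator (QDG).
   Context: A quantum finite-state generator (QG) with $n$ internal states (identified with the standard basis of $\mathbb{C}^n$) and finite output alphabet $Y$ consists of an $n\times n$ unitary matrix $U$ and nonzero projection operators $P(y)$, $y\in Y$, diagonal with entries $0$ and $1$ in the standard basis, with $\sum_{y\in Y}P(y)=\mathbb{1}$; its transition matrices are $T(y)=UP(y)$. A QCG is a QG observed via non-degenerate measurements, i.e. every $P(y)$ projects onto a one-dimensional subspace. A QDG is a QG in which each matrix $T(y)$ has at most one nonzero entry per row. *)

theory Defs
  imports "HOL-Analysis.Analysis"
begin

definition conj_transpose :: "complex ^ 'n ^ 'm \<Rightarrow> complex ^ 'm ^ 'n" where
  "conj_transpose A = (\<chi> i j. cnj (A $ j $ i))"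

definition unitary_matrix :: "complex ^ 'n ^ 'n \<Rightarrow> bool" where
  "unitary_matrix U \<longleftrightarrow> conj_transpose U ** U = mat 1 \<and> U ** conj_transpose U = mat 1"

definition projection_matrix :: "complex ^ 'n ^ 'n \<Rightarrow> bool" where
  "projection_matrix A \<longleftrightarrow> A ** A = A \<and> conj_transpose A = A"

definition zero_one_diagonal :: "complex ^ 'n ^ 'n \<Rightarrow> bool" where
  "zero_one_diagonal A \<longleftrightarrow>
    (\<forall>i j. i \<noteq> j \<longrightarrow> A $ i $ j = 0) \<and> (\<forall>i. A $ i $ i \<in> {0, 1})"

(* The internal states are the elements of the finite type 'n, state i being the
   standard basis vector axis i 1; Y is the output alphabet, and P is only
   relevant on Y. *)
definition QG :: "complex ^ 'n ^ 'n \<Rightarrow> 'y set \<Rightarrow> ('y \<Rightarrow> complex ^ 'n ^ 'n) \<Rightarrow> bool" where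
  "QG U Y P \<longleftrightarrow>
    finite Y \<and>
    unitary_matrix U \<and>
    (\<forall>y\<in>Y. P y \<noteq> 0 \<and> projection_matrix (P y) \<and> zero_one_diagonal (P y)) \<and>
    (\<Sum>y\<in>Y. P y) = mat 1"

definition transition_matrix ::
    "complex ^ 'n ^ 'n \<Rightarrow> ('y \<Rightarrow> complex ^ 'n ^ 'n) \<Rightarrow> 'y \<Rightarrow> complex ^ 'n ^ 'n" where
  "transition_matrix U P y = U ** P y"

(* vec.dim is the dimension over the scalar field complex (plain dim would be
   the real dimension). *)
definition QCG :: "complex ^ 'n ^ 'n \<Rightarrow> 'y set \<Rightarrow> ('y \<Rightarrow> complex ^ 'n ^ 'n) \<Rightarrow> bool" where
  "QCG U Y P \<longleftrightarrow> QG U Y P \<and> (\<forall>y\<in>Y. vec.dim (range (\<lambda>v. P y *v v)) = 1)"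

definition QDG :: "complex ^ 'n ^ 'n \<Rightarrow> 'y set \<Rightarrow> ('y \<Rightarrow> complex ^ 'n ^ 'n) \<Rightarrow> bool" where
  "QDG U Y P \<longleftrightarrow>
    QG U Y P \<and> (\<forall>y\<in>Y. \<forall>i. card {j. transition_matrix U P y $ i $ j \<noteq> 0} \<le> 1)"

end

theory Submission
  imports Defs
begin

text \<open>Multiplying \<open>U\<close> on the right by a diagonal matrix rescales the columns of
  \<open>U\<close>, so \<open>U ** P y\<close> can be nonzero only in columns \<open>j\<close> with
  \<open>P y $ j $ j\<close> nonzero (\<open>matrix_matrix_mult_diagonal_right\<close>). The number
  of such columns is bounded by the rank of \<open>P y\<close>
  (\<open>card_diagonal_le_dim_range\<close>), which is 1 for a non-degenerate measurement. Hence
  each row has at most one nonzero entry.\<close>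

lemma matrix_matrix_mult_diagonal_right:
  assumes "\<And>i j. i \<noteq> j \<Longrightarrow> A $ i $ j = 0"
  shows "(U ** A) $ i $ j = U $ i $ j * A $ j $ j"
proof -
  have "(U ** A) $ i $ j = (\<Sum>k\<in>UNIV. if k = j then U $ i $ j * A $ j $ j else 0)"
    unfolding matrix_matrix_mult_def vec_lambda_beta using assms by (intro sum.cong) auto
  then show ?thesis by simp
qed

text \<open>Every basis vector \<open>axis j 1\<close> whose diagonal entry is nonzero lies in the
  range of \<open>A\<close>, and distinct basis vectors are linearly independent.\<close>

lemma card_diagonal_le_dim_range:
  fixes A :: "'a::field ^ 'n ^ 'n"
  assumes diag: "\<And>i j. i \<noteq> j \<Longrightarrow> A $ i $ j = 0"
  shows "card {j. A $ j $ j \<noteq> 0} \<le> vec.dim (range (\<lambda>v. A *v v))"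
proof -
  let ?J = "{j. A $ j $ j \<noteq> 0}"
  let ?B = "(\<lambda>j. axis j 1) ` ?J :: ('a ^ 'n) set"
  \<comment> \<open>Column \<open>j\<close> of \<open>A\<close> is \<open>A $ j $ j\<close> times
    \<open>axis j 1\<close>; the preimage is scaled to cancel this factor.\<close>
  have "A *v axis j (1 / A $ j $ j) = axis j 1" if "A $ j $ j \<noteq> 0" for j
  proof -
    have "(A *v axis j (1 / A $ j $ j)) $ i = A $ i $ j * (1 / A $ j $ j)" for i
      by (simp add: matrix_vector_mult_def axis_def if_distrib cong: if_cong)
    then show ?thesis
      using that diag by (auto simp: vec_eq_iff axis_def)
  qed
  then have "?B \<subseteq> range (\<lambda>v. A *v v)"
    by (metis (mono_tags, lifting) image_subsetI mem_Collect_eq rangeI)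
  moreover have "vec.independent ?B"
    using independent_cart_basis by (rule vec.independent_mono) (auto simp: cart_basis_def)
  ultimately have "card ?B \<le> vec.dim (range (\<lambda>v. A *v v))"
    by (rule vec.independent_card_le_dim)
  moreover have "card ?B = card ?J"
    by (rule card_image) (auto simp: inj_on_def axis_eq_axis)
  ultimately show ?thesis by simp
qed

theorem proposition11:
  fixes U :: "complex ^ 'n ^ 'n"
    and Y :: "'y set"
    and P :: "'y \<Rightarrow> complex ^ 'n ^ 'n"
  assumes "QCG U Y P"
  shows "QDG U Y P"
proof -
  have "card {j. transition_matrix U P y $ i $ j \<noteq> 0} \<le> 1" if "y \<in> Y" for y i
  proof -
    have diag: "\<And>i j. i \<noteq> j \<Longrightarrow> P y $ i $ j = 0" and dim: "vec.dim (range (\<lambda>v. P y *v v)) = 1"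
      using assms that by (auto simp: QCG_def QG_def zero_one_diagonal_def)
    \<comment> \<open>The bounding set is independent of the row \<open>i\<close>: all rows of
      \<open>transition_matrix U P y\<close> are supported in the same columns.\<close>
    have "{j. transition_matrix U P y $ i $ j \<noteq> 0} \<subseteq> {j. P y $ j $ j \<noteq> 0}"
      by (auto simp: transition_matrix_def matrix_matrix_mult_diagonal_right[OF diag])
    then have "card {j. transition_matrix U P y $ i $ j \<noteq> 0} \<le> card {j. P y $ j $ j \<noteq> 0}"
      by (simp add: card_mono)
    also have "\<dots> \<le> 1"
      using card_diagonal_le_dim_range[OF diag] dim by simp
    finally show ?thesis .
  qed
  then show ?thesis
    using assms by (simp add: QCG_def QDG_def)
qed

end
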